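(* No mechanism simultaneously satisfies ex-post favoring-eagerness-for-remaining-items (ep-FERI), ex-ante favoring-eagerness-for-remaining-items (ea-FERI), and strong equal treatment of equals (SETE).
   Context: Setting. An assignment problem has a set $N=\{1,\dots,n\}$ of agents and a set $M$ of $n$ items (one unit each). A preference profile $R=(\succ_j)_{j\in N}$ gives each agent $j$ a strict linear order $\succ_j$ on $M$. For nonempty $S\subseteq M$, $\mathrm{top}(j,S)$ is the $\succ_j$-best item of $S$; $rk(j,o)$ is the rank of $o$ in $\succ_j$ ($1$ = best). $U(\succ_j,o)=\{o'\in M:o'\succ_jo\}\cup\{o\}$. A random assignment is a doubly stochastic $n\times n$ matrix $P=[p_{j,o}]$. A deterministic assignment is a bijection $A:N\to M$, identified with its permutation matrix. A mechanism assigns to every preference profile (of every assignment problem, of any size $n$) a random assignment; it satisfies a property of random assignments if its output satisfies it for every profile. FERI. For a deterministic assignment $A$ define recursively for $r=1,2,\dots$: $T_{A,r}=\{o\in M: o=\mathrm{top}(j,M\setminus\bigcup_{r'<r}T_{A,r'})\text{ for some }j\in N\text{ with }A(j)\notin\bigcup_{r'<r}T_{A,r'}\}$. $A$ satisfies FERI if for every $r\ge 1$ and every $o\in T_{A,r}$, $o=\mathrm{top}(A^{-1}(o),M\setminus\bigcup_{r'<r}T_{A,r'})$. A random assignment satisfies ep-FERI if it is a convex combination of deterministic assignments satisfying FERI. ea-FERI. Given $P$, put $M_{P,0}=\emptyset$ and $E_{P,0}(o)=\emptyset$ for all $o$. For $r=1,2,\dots$ define recursively $M_{P,r}=\{o\in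 M:\sum_{k\in\bigcup_{r'<r}E_{P,r'}(o)}p_{k,o}<1\}$ and, for $o\in M_{P,r}$, $E_{P,r}(o)=\{j\in N:o=\mathrm{top}(j,M_{P,r})\}$ (with $E_{P,r}(o)=\emptyset$ for $o\notin M_{P,r}$). $P$ satisfies ea-FERI if for every $r\ge1$, every $o\in M_{P,r}$ and every $j\in N$: if $j\in E_{P,r'}(o)$ for some $r'<r$, then $\sum_{o'\in U(\succ_j,o)}p_{j,o'}=1$. SETE: for agents $j,k$, their common prefix is the set $M'\subseteq M$ such that $rk(j,o)=rk(k,o)\le|M'|$ for all $o\in M'$ and $\mathrm{top}(j,M\setminus M')\neq\mathrm{top}(k,M\setminus M')$ (with $M'=M$ if $\succ_j=\succ_k$). $P$ satisfies SETE if $p_{j,o}=p_{k,o}$ for all $j,k\in N$ and all $o$ in the common prefix of $j$ and $k$. *)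

theory Defs
  imports "HOL-Library.FuncSet" "HOL-Library.Infinite_Typeclass"
begin

text \<open>
  Agents are the numbers \<open>1, \<dots>, n\<close>; the items of a problem are a set \<open>M\<close> of \<open>n\<close> elements of
  an infinite type \<open>'o\<close>, so that there are problems of every size.  A preference relation
  is strict: \<open>(a, b) \<in> r\<close> says that \<open>a\<close> is preferred to \<open>b\<close>.  Profiles are extensional, i.e.
  they carry no information beyond the preferences of the \<open>n\<close> agents over \<open>M\<close>.
\<close>

type_synonym 'o profile = "nat \<Rightarrow> 'o rel"
type_synonym 'o random_assignment = "nat \<Rightarrow> 'o \<Rightarrow> real"
type_synonym 'o mechanism = "nat \<Rightarrow> 'o set \<Rightarrow> 'o profile \<Rightarrow> 'o random_assignment"

definition preferences :: "'o set \<Rightarrow> 'o rel set" where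
  "preferences M = {r. r \<subseteq> M \<times> M \<and> strict_linear_order_on M r}"

definition assignment_problem :: "nat \<Rightarrow> 'o set \<Rightarrow> 'o profile \<Rightarrow> bool" where
  "assignment_problem n M R \<longleftrightarrow>
     n \<ge> 1 \<and> finite M \<and> card M = n \<and> R \<in> {1..n} \<rightarrow>\<^sub>E preferences M"

text \<open>Unspecified for empty \<open>S\<close>; all uses below are guarded accordingly.\<close>

definition top_item :: "'o profile \<Rightarrow> nat \<Rightarrow> 'o set \<Rightarrow> 'o" where
  "top_item R j S = (THE x. x \<in> S \<and> (\<forall>y\<in>S. y \<noteq> x \<longrightarrow> (x, y) \<in> R j))"

definition rk :: "'o set \<Rightarrow> 'o profile \<Rightarrow> nat \<Rightarrow> 'o \<Rightarrow> nat" where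
  "rk M R j x = card {y \<in> M. (y, x) \<in> R j} + 1"

definition upper_set :: "'o set \<Rightarrow> 'o profile \<Rightarrow> nat \<Rightarrow> 'o \<Rightarrow> 'o set" where
  "upper_set M R j x = {y \<in> M. (y, x) \<in> R j} \<union> {x}"

definition random_assignment :: "nat \<Rightarrow> 'o set \<Rightarrow> 'o random_assignment \<Rightarrow> bool" where
  "random_assignment n M P \<longleftrightarrow>
     (\<forall>j\<in>{1..n}. \<forall>x\<in>M. P j x \<ge> 0) \<and>
     (\<forall>j\<in>{1..n}. (\<Sum>x\<in>M. P j x) = 1) \<and>
     (\<forall>x\<in>M. (\<Sum>j\<in>{1..n}. P j x) = 1)"

definition deterministic_assignment :: "nat \<Rightarrow> 'o set \<Rightarrow> (nat \<Rightarrow> 'o) \<Rightarrow> bool" where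
  "deterministic_assignment n M A \<longleftrightarrow> bij_betw A {1..n} M"

definition permutation_matrix :: "(nat \<Rightarrow> 'o) \<Rightarrow> 'o random_assignment" where
  "permutation_matrix A j x = (if A j = x then 1 else 0)"

text \<open>Rounds are numbered from 1; the value at \<open>r = 0\<close> is never used.\<close>

fun round_tops ::
  "nat \<Rightarrow> 'o set \<Rightarrow> 'o profile \<Rightarrow> (nat \<Rightarrow> 'o) \<Rightarrow> nat \<Rightarrow> 'o set" where
  "round_tops n M R A r =
     {x \<in> M. \<exists>j\<in>{1..n}. A j \<notin> (\<Union>r'\<in>{1..<r}. round_tops n M R A r') \<and>
        x = top_item R j (M - (\<Union>r'\<in>{1..<r}. round_tops n M R A r'))}"

declare round_tops.simps [simp del]

definition FERI :: "nat \<Rightarrow> 'o set \<Rightarrow> 'o profile \<Rightarrow> (nat \<Rightarrow> 'o) \<Rightarrow> bool" where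
  "FERI n M R A \<longleftrightarrow>
     (\<forall>r\<ge>1. \<forall>x \<in> round_tops n M R A r.
        x = top_item R (inv_into {1..n} A x) (M - (\<Union>r'\<in>{1..<r}. round_tops n M R A r')))"

definition ep_FERI :: "nat \<Rightarrow> 'o set \<Rightarrow> 'o profile \<Rightarrow> 'o random_assignment \<Rightarrow> bool" where
  "ep_FERI n M R P \<longleftrightarrow>
     (\<exists>\<A> w. finite \<A> \<and>
        (\<forall>A\<in>\<A>. deterministic_assignment n M A \<and> FERI n M R A) \<and>
        (\<forall>A\<in>\<A>. (w A :: real) \<ge> 0) \<and> (\<Sum>A\<in>\<A>. w A) = 1 \<and>
        (\<forall>j\<in>{1..n}. \<forall>x\<in>M. P j x = (\<Sum>A\<in>\<A>. w A * permutation_matrix A j x)))"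

function remaining :: "nat \<Rightarrow> 'o set \<Rightarrow> 'o profile \<Rightarrow> 'o random_assignment \<Rightarrow> nat \<Rightarrow> 'o set"
  and eager :: "nat \<Rightarrow> 'o set \<Rightarrow> 'o profile \<Rightarrow> 'o random_assignment \<Rightarrow> nat \<Rightarrow> 'o \<Rightarrow> nat set"
where
  "remaining n M R P r =
     (if r = 0 then {} else {x \<in> M. (\<Sum>k \<in> (\<Union>r'\<in>{..<r}. eager n M R P r' x). P k x) < 1})"
| "eager n M R P r x =
     (if x \<in> remaining n M R P r
      then {j \<in> {1..n}. x = top_item R j (remaining n M R P r)} else {})"
  by pat_completeness auto
termination
  by (relation "measure (\<lambda>z. case z of Inl (n, M, R, P, r) \<Rightarrow> 2 * r
                                     | Inr (n, M, R, P, r, x) \<Rightarrow> 2 * r + 1)") auto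

declare remaining.simps [simp del] eager.simps [simp del]

definition ea_FERI :: "nat \<Rightarrow> 'o set \<Rightarrow> 'o profile \<Rightarrow> 'o random_assignment \<Rightarrow> bool" where
  "ea_FERI n M R P \<longleftrightarrow>
     (\<forall>r\<ge>1. \<forall>x \<in> remaining n M R P r. \<forall>j\<in>{1..n}.
        (\<exists>r'<r. j \<in> eager n M R P r' x) \<longrightarrow> (\<Sum>y \<in> upper_set M R j x. P j y) = 1)"

text \<open>The common prefix of two agents exists and is unique; it is described as a relation.\<close>

definition is_common_prefix ::
  "'o set \<Rightarrow> 'o profile \<Rightarrow> nat \<Rightarrow> nat \<Rightarrow> 'o set \<Rightarrow> bool" where
  "is_common_prefix M R j k M' \<longleftrightarrow>
     M' \<subseteq> M \<and>
     (\<forall>x\<in>M'. rk M R j x = rk M R k x \<and> rk M R k x \<le> card M') \<and>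
     (if R j = R k then M' = M
      else top_item R j (M - M') \<noteq> top_item R k (M - M'))"

definition SETE :: "nat \<Rightarrow> 'o set \<Rightarrow> 'o profile \<Rightarrow> 'o random_assignment \<Rightarrow> bool" where
  "SETE n M R P \<longleftrightarrow>
     (\<forall>j\<in>{1..n}. \<forall>k\<in>{1..n}. \<forall>M'. is_common_prefix M R j k M' \<longrightarrow>
        (\<forall>x\<in>M'. P j x = P k x))"

definition is_mechanism :: "'o mechanism \<Rightarrow> bool" where
  "is_mechanism f \<longleftrightarrow>
     (\<forall>n M R. assignment_problem n M R \<longrightarrow> random_assignment n M (f n M R))"

definition mechanism_satisfies ::
  "'o mechanism \<Rightarrow> (nat \<Rightarrow> 'o set \<Rightarrow> 'o profile \<Rightarrow> 'o random_assignment \<Rightarrow> bool) \<Rightarrow> bool" where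
  "mechanism_satisfies f Q \<longleftrightarrow>
     (\<forall>n M R. assignment_problem n M R \<longrightarrow> Q n M R (f n M R))"

end

theory Submission
  imports Defs
begin

text \<open>
  The three properties already conflict on one profile with seven agents.  All agents rank
  \<open>a\<close> first; next, agents 1, 2, 3 want \<open>z\<close>, \<open>y\<close>, \<open>x\<close>, agents 4, 5 want \<open>c, z, y, x\<close> and agents
  6, 7 want \<open>c, w, x\<close>, in this order.

  By SETE everybody gets \<open>1/7\<close> of \<open>a\<close>, and agents 4 to 7 get \<open>1/4\<close> of \<open>c\<close> each in round 2,
  while agents 1, 2, 3 leave \<open>1/7\<close> of \<open>z\<close>, \<open>y\<close>, \<open>x\<close>.  In round 3 agents 6, 7 exhaust \<open>w\<close>; agents
  4, 5 turn to the remainder of \<open>z\<close>, and \<open>y\<close> is still left over in round 4.  So in round 4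
  agents 6, 7 but not 4, 5 demand \<open>x\<close>, and they exhaust it: ea-FERI gives agents 4, 5
  nothing of \<open>x\<close>.  But with probability \<open>1/7\<close> agent 3 wins \<open>a\<close>.  Then \<open>z\<close> and \<open>y\<close> are both gone
  after round 2, at least one of 4, 5 is still unserved and asks for \<open>x\<close> in round 3, when
  6, 7 still ask for \<open>w\<close>; by FERI one of 4, 5 gets \<open>x\<close>.
\<close>

section \<open>Preferences given by lists\<close>

primrec list_preference :: "'o list \<Rightarrow> 'o rel" where
  "list_preference [] = {}"
| "list_preference (x # xs) = {x} \<times> set xs \<union> list_preference xs"

lemma list_preference_append:
  "list_preference (xs @ ys) = list_preference xs \<union> list_preference ys \<union> set xs \<times> set ys"
  by (induction xs) auto

lemma list_preference_subset: "list_preference l \<subseteq> set l \<times> set l"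
  by (induction l) auto

lemma list_preference_in_preferences:
  assumes "distinct l"
  shows "list_preference l \<in> preferences (set l)"
proof -
  have "trans (list_preference l) \<and> irrefl (list_preference l) \<and> total_on (set l) (list_preference l)"
    using assms
  proof (induction l)
    case Nil
    show ?case by (simp add: trans_def irrefl_def)
  next
    case (Cons x xs)
    have sub: "p \<in> set xs \<and> q \<in> set xs" if "(p, q) \<in> list_preference xs" for p q
      using that list_preference_subset[of xs] by blast
    have tr: "trans (list_preference xs)" and ir: "irrefl (list_preference xs)"
      and tot: "total_on (set xs) (list_preference xs)" and "x \<notin> set xs"
      using Cons by auto
    have "trans (list_preference (x # xs))"
    proof (rule transI)
      fix p q r
      assume pq: "(p, q) \<in> list_preference (x # xs)" and qr: "(q, r) \<in> list_preference (x # xs)"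
      then have "q \<in> set xs" "(q, r) \<in> list_preference xs"
        using sub \<open>x \<notin> set xs\<close> by auto
      then show "(p, r) \<in> list_preference (x # xs)"
        using pq sub transD[OF tr, of p q r] by auto
    qed
    moreover have "irrefl (list_preference (x # xs))"
      using ir \<open>x \<notin> set xs\<close> by (auto simp: irrefl_def)
    moreover have "total_on (set (x # xs)) (list_preference (x # xs))"
      using tot by (auto simp: total_on_def)
    ultimately show ?case by blast
  qed
  then show ?thesis
    using list_preference_subset by (auto simp: preferences_def strict_linear_order_on_def)
qed

lemma list_preference_above_iff:
  assumes "distinct (us @ t # vs)"
  shows "(y, t) \<in> list_preference (us @ t # vs) \<longleftrightarrow> y \<in> set us"
  using assms list_preference_subset[of us] list_preference_subset[of vs]
  by (auto simp: list_preference_append)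

lemma list_preference_below:
  assumes "y \<in> set vs"
  shows "(t, y) \<in> list_preference (us @ t # vs)"
  using assms by (simp add: list_preference_append)

text \<open>Within the list, \<open>S\<close> matters only through containing \<open>t\<close> and
  missing \<open>us\<close>. The top can thus be read off from partial knowledge of
  \<open>S\<close>, as in round 4 of the ex-ante argument.\<close>

lemma top_item_list:
  assumes R: "R j = list_preference (us @ t # vs)" and "distinct (us @ t # vs)"
    and "S \<subseteq> set (us @ t # vs)" "t \<in> S" "set us \<inter> S = {}"
  shows "top_item R j S = t"
  unfolding top_item_def
proof (rule the_equality)
  have "y \<in> set vs" if "y \<in> S" "y \<noteq> t" for y
    using that assms(3,5) by auto
  then show "t \<in> S \<and> (\<forall>y\<in>S. y \<noteq> t \<longrightarrow> (t, y) \<in> R j)"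
    unfolding R using list_preference_below[of _ vs t us] \<open>t \<in> S\<close> by blast
next
  fix x assume x: "x \<in> S \<and> (\<forall>y\<in>S. y \<noteq> x \<longrightarrow> (x, y) \<in> R j)"
  show "x = t"
  proof (rule ccontr)
    assume "x \<noteq> t"
    then have "(x, t) \<in> R j" using x \<open>t \<in> S\<close> by auto
    then have "x \<in> set us" unfolding R list_preference_above_iff[OF assms(2)] .
    then show False using x assms(5) by blast
  qed
qed

lemma upper_set_list:
  assumes "R j = list_preference (us @ t # vs)" and "distinct (us @ t # vs)"
    and "set us \<subseteq> M"
  shows "upper_set M R j t = insert t (set us)"
  using assms by (auto simp: upper_set_def list_preference_above_iff simp del: distinct_append)

lemma rk_list:
  assumes "R j = list_preference (us @ t # vs)" and "distinct (us @ t # vs)"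
    and "set us \<subseteq> M"
  shows "rk M R j t = length us + 1"
proof -
  have "{y \<in> M. (y, t) \<in> R j} = set us"
    using assms by (auto simp: list_preference_above_iff simp del: distinct_append)
  then show ?thesis using assms(2) by (simp add: rk_def distinct_card)
qed

text \<open>Entries of \<open>us\<close> have their position as rank for both agents, and the items
  just behind \<open>us\<close> are the two tops that must differ.\<close>

lemma is_common_prefix_list:
  assumes Rj: "R j = list_preference (us @ s # vs)" and dj: "distinct (us @ s # vs)"
    and sj: "set (us @ s # vs) = M"
    and Rk: "R k = list_preference (us @ t # ws)" and dk: "distinct (us @ t # ws)"
    and sk: "set (us @ t # ws) = M"
    and "s \<noteq> t"
  shows "is_common_prefix M R j k (set us)"
proof -
  have "top_item R j (M - set us) = s"
    using dj sj by (intro top_item_list[where us = us and vs = vs] Rj) auto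
  moreover have "top_item R k (M - set us) = t"
    using dk sk by (intro top_item_list[where us = us and vs = ws] Rk) auto
  ultimately have tops: "top_item R j (M - set us) \<noteq> top_item R k (M - set us)"
    using \<open>s \<noteq> t\<close> by simp
  \<comment> \<open>\<open>top_item\<close> sees only the agent's own relation, so equal relations
    would give equal tops.\<close>
  then have "R j \<noteq> R k" by (auto simp: top_item_def)
  moreover have "rk M R j x = rk M R k x \<and> rk M R k x \<le> card (set us)" if x: "x \<in> set us" for x
  proof -
    obtain p q where us: "us = p @ x # q" using split_list[OF x] by blast
    have "rk M R j x = length p + 1"
      using Rj dj sj us by (intro rk_list[where vs = "q @ s # vs"]) auto
    moreover have "rk M R k x = length p + 1"
      using Rk dk sk us by (intro rk_list[where vs = "q @ t # ws"]) auto
    moreover have "card (set us) = length us" using dj by (simp add: distinct_card)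
    ultimately show ?thesis using us by simp
  qed
  ultimately show ?thesis using tops sj by (auto simp: is_common_prefix_def)
qed

section \<open>Eager agents\<close>

text \<open>The agents whose shares count against \<open>x\<close> in round \<open>r\<close>. The
  strict bound makes the passage to \<open>Suc r\<close> add those eager in round \<open>r\<close>,
  so rounds can be computed one by one.\<close>

definition claimants :: "nat \<Rightarrow> 'o set \<Rightarrow> 'o profile \<Rightarrow> 'o random_assignment \<Rightarrow> nat \<Rightarrow> 'o \<Rightarrow> nat set"
  where "claimants n M R P r x = (\<Union>r'<r. eager n M R P r' x)"

lemma claimants_Suc: "claimants n M R P (Suc r) x = claimants n M R P r x \<union> eager n M R P r x"
  by (auto simp: claimants_def lessThan_Suc)

text \<open>Round 0 has no remaining items by convention, hence no eager agents.\<close>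

lemma claimants_one: "claimants n M R P (Suc 0) x = {}"
  by (simp add: claimants_def lessThan_Suc eager.simps remaining.simps)

lemma claimants_subset: "claimants n M R P r x \<subseteq> {1..n}"
  by (auto simp: claimants_def eager.simps split: if_splits)

lemma mem_remaining_iff:
  "x \<in> remaining n M R P (Suc r) \<longleftrightarrow> x \<in> M \<and> (\<Sum>k\<in>claimants n M R P (Suc r) x. P k x) < 1"
  by (subst remaining.simps) (simp add: claimants_def)

lemma remaining_one: "remaining n M R P (Suc 0) = M"
  by (auto simp: mem_remaining_iff claimants_one)

lemma mem_eager_iff:
  "j \<in> eager n M R P r x \<longleftrightarrow>
     x \<in> remaining n M R P r \<and> j \<in> {1..n} \<and> top_item R j (remaining n M R P r) = x"
  by (auto simp: eager.simps)

text \<open>Claimant sets grow and shares are nonnegative, so the claimed part of an item never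
  shrinks. The comparison starts at round 1 because \<open>remaining\<close> is empty at 0.\<close>

lemma remaining_Suc_subset:
  assumes "random_assignment n M P"
  shows "remaining n M R P (Suc (Suc r)) \<subseteq> remaining n M R P (Suc r)"
proof
  fix x assume x: "x \<in> remaining n M R P (Suc (Suc r))"
  have "(\<Sum>k\<in>claimants n M R P (Suc r) x. P k x) \<le> (\<Sum>k\<in>claimants n M R P (Suc (Suc r)) x. P k x)"
  proof (rule sum_mono2)
    show "finite (claimants n M R P (Suc (Suc r)) x)"
      by (rule finite_subset[OF claimants_subset]) simp
    show "claimants n M R P (Suc r) x \<subseteq> claimants n M R P (Suc (Suc r)) x"
      unfolding claimants_Suc[of _ _ _ _ "Suc r"] by blast
    show "0 \<le> P k x" if "k \<in> claimants n M R P (Suc (Suc r)) x - claimants n M R P (Suc r) x" for k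
      using that x assms claimants_subset[of n M R P "Suc (Suc r)" x]
      by (auto simp: random_assignment_def mem_remaining_iff)
  qed
  then show "x \<in> remaining n M R P (Suc r)"
    using x unfolding mem_remaining_iff by linarith
qed

lemma ea_FERI_D:
  assumes "ea_FERI n M R P" "x \<in> remaining n M R P (Suc r)" "j \<in> claimants n M R P (Suc r) x"
  shows "(\<Sum>y\<in>upper_set M R j x. P j y) = 1"
proof -
  have "j \<in> {1..n}" by (rule subsetD[OF claimants_subset assms(3)])
  moreover have "\<exists>r'<Suc r. j \<in> eager n M R P r' x" using assms(3) by (auto simp: claimants_def)
  moreover have "1 \<le> Suc r" by simp
  ultimately show ?thesis using assms(1,2) unfolding ea_FERI_def by blast
qed

text \<open>The claimants of an exhausted item hold at least one unit and its whole column sums to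
  one, so the nonnegative shares of all other agents vanish.\<close>

lemma random_assignment_exhausted:
  assumes P: "random_assignment n M P" and "x \<in> M" "x \<notin> remaining n M R P (Suc r)"
  shows "(\<Sum>k\<in>claimants n M R P (Suc r) x. P k x) = 1"
    and "j \<in> {1..n} - claimants n M R P (Suc r) x \<Longrightarrow> P j x = 0"
proof -
  let ?C = "claimants n M R P (Suc r) x"
  have split: "(\<Sum>k\<in>{1..n}. P k x) = (\<Sum>k\<in>{1..n} - ?C. P k x) + (\<Sum>k\<in>?C. P k x)"
    by (rule sum.subset_diff[OF claimants_subset]) simp
  have nonneg: "P k x \<ge> 0" if "k \<in> {1..n} - ?C" for k
    using that P \<open>x \<in> M\<close> by (auto simp: random_assignment_def)
  have one: "(\<Sum>k\<in>{1..n}. P k x) = 1" using P \<open>x \<in> M\<close> by (auto simp: random_assignment_def)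
  have ge: "(\<Sum>k\<in>?C. P k x) \<ge> 1" using assms by (auto simp: mem_remaining_iff)
  have "(\<Sum>k\<in>{1..n} - ?C. P k x) \<ge> 0" by (rule sum_nonneg) (rule nonneg)
  then show "(\<Sum>k\<in>?C. P k x) = 1" using split one ge by linarith
  then have "(\<Sum>k\<in>{1..n} - ?C. P k x) = 0" using split one by linarith
  then have "\<forall>k\<in>{1..n} - ?C. P k x = 0"
    using nonneg sum_nonneg_eq_0_iff[of "{1..n} - ?C" "\<lambda>k. P k x"] by blast
  then show "P j x = 0" if "j \<in> {1..n} - ?C"
    using that by blast
qed

section \<open>The profile\<close>

text \<open>Keeps agent \<open>1\<close> a numeral, as it is in the facts about its top items.\<close>

declare One_nat_def [simp del]

locale seven_items =
  fixes a c z y w x v :: 'o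
  assumes distinct_items: "distinct [a, c, z, y, w, x, v]"
begin

definition items :: "'o set" where
  "items = {a, c, z, y, w, x, v}"

text \<open>The item \<open>v\<close> makes the number of items seven. Agents 1 and 2 turn to it
  once \<open>z\<close> and \<open>y\<close> are gone, and so stay away from \<open>w\<close> and
  \<open>x\<close>.\<close>

definition ranking :: "nat \<Rightarrow> 'o list" where
  "ranking j =
     (if j = 1 then [a, z, v, c, y, w, x]
      else if j = 2 then [a, y, v, c, z, w, x]
      else if j = 3 then [a, x, v, c, z, y, w]
      else if j = 4 \<or> j = 5 then [a, c, z, y, x, w, v]
      else [a, c, w, x, z, y, v])"

definition profile :: "'o profile" where
  "profile = (\<lambda>j\<in>{1..7}. list_preference (ranking j))"

lemma atLeastAtMost_7: "{1..7} = {1, 2, 3, 4, 5, 6, 7::nat}"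
  by auto

lemma item_neqs:
  "a \<noteq> c" "a \<noteq> z" "a \<noteq> y" "a \<noteq> w" "a \<noteq> x" "a \<noteq> v"
  "c \<noteq> a" "c \<noteq> z" "c \<noteq> y" "c \<noteq> w" "c \<noteq> x" "c \<noteq> v"
  "z \<noteq> a" "z \<noteq> c" "z \<noteq> y" "z \<noteq> w" "z \<noteq> x" "z \<noteq> v"
  "y \<noteq> a" "y \<noteq> c" "y \<noteq> z" "y \<noteq> w" "y \<noteq> x" "y \<noteq> v"
  "w \<noteq> a" "w \<noteq> c" "w \<noteq> z" "w \<noteq> y" "w \<noteq> x" "w \<noteq> v"
  "x \<noteq> a" "x \<noteq> c" "x \<noteq> z" "x \<noteq> y" "x \<noteq> w" "x \<noteq> v"
  "v \<noteq> a" "v \<noteq> c" "v \<noteq> z" "v \<noteq> y" "v \<noteq> w" "v \<noteq> x"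
  using distinct_items by auto

lemma distinct_ranking: "distinct (ranking j)"
  by (simp add: ranking_def item_neqs)

lemma set_ranking: "set (ranking j) = items"
  by (auto simp: ranking_def items_def)

lemma profile_eq: "j \<in> {1..7} \<Longrightarrow> profile j = list_preference (ranking j)"
  by (simp add: profile_def)

lemma assignment_problem_profile: "assignment_problem 7 items profile"
proof -
  have "card items = 7" by (simp add: items_def item_neqs)
  moreover have "list_preference (ranking j) \<in> preferences items" for j
    using list_preference_in_preferences[OF distinct_ranking] by (simp add: set_ranking)
  ultimately show ?thesis
    by (auto simp: assignment_problem_def items_def profile_def)
qed

lemma top_item_profile:
  assumes "ranking j = us @ t # vs" "j \<in> {1..7}" "S \<subseteq> items" "t \<in> S" "set us \<inter> S = {}"
  shows "top_item profile j S = t"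
  using assms distinct_ranking[of j] set_ranking[of j]
  by (intro top_item_list[where us = us and vs = vs]) (auto simp: profile_eq)

lemma upper_set_profile:
  assumes "ranking j = us @ t # vs" "j \<in> {1..7}"
  shows "upper_set items profile j t = insert t (set us)"
  using assms distinct_ranking[of j] set_ranking[of j]
  by (intro upper_set_list[where vs = vs]) (auto simp: profile_eq)

lemma SETE_profile:
  assumes "SETE 7 items profile P" "j \<in> {1..7}" "k \<in> {1..7}"
    and "ranking j = us @ s # vs" "ranking k = us @ t # ws" "s \<noteq> t" "q \<in> set us"
  shows "P j q = P k q"
proof -
  have "is_common_prefix items profile j k (set us)"
    using assms distinct_ranking[of j] set_ranking[of j] distinct_ranking[of k] set_ranking[of k]
    by (intro is_common_prefix_list) (auto simp: profile_eq)
  then show ?thesis using assms by (auto simp: SETE_def)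
qed

lemma tops_1: "j \<in> {1..7} \<Longrightarrow> top_item profile j items = a"
  by (rule top_item_profile[where us = "[]" and vs = "tl (ranking j)"])
     (auto simp: ranking_def items_def)

lemma tops_2:
  defines "S \<equiv> {c, z, y, w, x, v}"
  shows "top_item profile 1 S = z" "top_item profile 2 S = y" "top_item profile 3 S = x"
    "top_item profile 4 S = c" "top_item profile 5 S = c"
    "top_item profile 6 S = c" "top_item profile 7 S = c"
  by (rule top_item_profile[where us = "[a]"];
      auto simp: S_def ranking_def items_def item_neqs)+

text \<open>The set left ex ante after round 2, when only \<open>a\<close> and \<open>c\<close> are
  exhausted.\<close>

lemma tops_3:
  defines "S \<equiv> {z, y, w, x, v}"
  shows "top_item profile 1 S = z" "top_item profile 2 S = y" "top_item profile 3 S = x"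
    "top_item profile 4 S = z" "top_item profile 5 S = z"
    "top_item profile 6 S = w" "top_item profile 7 S = w"
  by (rule top_item_profile[where us = "[a]"] top_item_profile[where us = "[a, c]"];
      auto simp: S_def ranking_def items_def item_neqs; fail)+

text \<open>The set left ex post after round 2 if agent 3 holds \<open>a\<close>: here
  \<open>z\<close> and \<open>y\<close> are gone as well.\<close>

lemma tops_3_ex_post:
  defines "S \<equiv> {w, x, v}"
  shows "top_item profile 1 S = v" "top_item profile 2 S = v" "top_item profile 3 S = x"
    "top_item profile 4 S = x" "top_item profile 5 S = x"
    "top_item profile 6 S = w" "top_item profile 7 S = w"
  by (rule top_item_profile[where us = "[a]"] top_item_profile[where us = "[a, c]"]
      top_item_profile[where us = "[a, z]"] top_item_profile[where us = "[a, y]"]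
      top_item_profile[where us = "[a, c, z, y]"];
      auto simp: S_def ranking_def items_def item_neqs; fail)+

section \<open>The ex-post side\<close>

lemma FERI_imp_x_to_4_or_5:
  assumes bij: "deterministic_assignment 7 items A" and FERI: "FERI 7 items profile A"
    and A3: "A 3 = a"
  shows "A 4 = x \<or> A 5 = x"
proof -
  let ?T = "round_tops 7 items profile A"
  let ?own = "inv_into {1..7::nat} A"
  have inj: "inj_on A {1..7}" and img: "A ` {1..7} = items"
    using bij by (auto simp: deterministic_assignment_def bij_betw_def)
  have own: "?own q \<in> {1..7}" "A (?own q) = q" if "q \<in> items" for q
    using that inv_into_into[of q A "{1..7}"] f_inv_into_f[of q A "{1..7}"] by (simp_all only: img)
  have not_a: "A j \<noteq> a" if "j \<in> {1..7}" "j \<noteq> 3" for j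
    using that A3 inj_onD[OF inj, of j 3] by auto
  have T1: "?T 1 = {a}"
  proof -
    have "?T 1 = {q \<in> items. \<exists>j\<in>{1..7}. q = top_item profile j items}"
      by (subst round_tops.simps) simp
    also have "\<dots> = {a}" using tops_1 by (auto simp: items_def)
    finally show ?thesis .
  qed
  have U2: "(\<Union>r'\<in>{1..<2}. ?T r') = {a}"
  proof -
    have "{1..<2} = {1::nat}" by auto
    then show ?thesis using T1 by simp
  qed
  have rem2: "items - {a} = {c, z, y, w, x, v}" by (auto simp: items_def item_neqs)
  have "?T 2 = {q \<in> items. \<exists>j\<in>{1..7}. A j \<noteq> a \<and> q = top_item profile j {c, z, y, w, x, v}}"
    by (subst round_tops.simps) (simp only: U2 rem2 singleton_iff)
  \<comment> \<open>Agent 3, the only one with top \<open>x\<close> in this round, holds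
    \<open>a\<close> and no longer asks; hence \<open>x\<close> is not taken in round 2.\<close>
  also have "\<dots> = {q \<in> items. q = z \<or> q = y \<or> q = c}"
    using not_a A3 unfolding atLeastAtMost_7 by (simp add: tops_2)
  also have "\<dots> = {c, z, y}" by (auto simp: items_def)
  finally have T2: "?T 2 = {c, z, y}" .
  have U3: "(\<Union>r'\<in>{1..<3}. ?T r') = {a, c, z, y}"
  proof -
    have "{1..<3} = {1, 2::nat}" by auto
    then show ?thesis using T1 T2 by auto
  qed
  have rem3: "items - {a, c, z, y} = {w, x, v}" by (auto simp: items_def item_neqs)
  have top2: "q = top_item profile (?own q) {c, z, y, w, x, v}" if "q \<in> {c, z, y}" for q
    using FERI[unfolded FERI_def, rule_format, of 2 q] that T2 U2 rem2 by simp
  have top3: "q = top_item profile (?own q) {w, x, v}" if "q \<in> ?T 3" for q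
    using FERI[unfolded FERI_def, rule_format, of 3 q] that U3 rem3 by simp
  \<comment> \<open>FERI gives \<open>z\<close> to an agent who has it on top in round 2, and agent
    1 is the only one; likewise agent 2 for \<open>y\<close>.\<close>
  have "k = 1" if "k \<in> {1..7}" "z = top_item profile k {c, z, y, w, x, v}" for k
    using that unfolding atLeastAtMost_7 by (auto simp: tops_2 item_neqs)
  then have "?own z = 1" using own(1) top2 by (simp add: items_def)
  then have A1: "A 1 = z" using own(2)[of z] by (simp add: items_def)
  have "k = 2" if "k \<in> {1..7}" "y = top_item profile k {c, z, y, w, x, v}" for k
    using that unfolding atLeastAtMost_7 by (auto simp: tops_2 item_neqs)
  then have "?own y = 2" using own(1) top2 by (simp add: items_def)
  then have A2: "A 2 = y" using own(2)[of y] by (simp add: items_def)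
  \<comment> \<open>The single unit of \<open>c\<close> cannot serve both agents; the other one is
    still unserved in round 3.\<close>
  have "\<exists>j\<in>{4, 5}. A j \<noteq> c"
  proof (rule ccontr)
    assume "\<not> ?thesis"
    then have "A 4 = A 5" by simp
    then show False using inj_onD[OF inj, of 4 5] by simp
  qed
  then obtain j where j: "j \<in> {4, 5}" "A j \<noteq> c" by blast
  then have j7: "j \<in> {1..7}" "j \<noteq> 1" "j \<noteq> 2" "j \<noteq> 3" by auto
  have "A j \<noteq> z" using j7 inj_onD[OF inj, of j 1] A1 by auto
  moreover have "A j \<noteq> y" using j7 inj_onD[OF inj, of j 2] A2 by auto
  moreover have "A j \<noteq> a" using j7 not_a by blast
  ultimately have "A j \<notin> {a, c, z, y}" using j by simp
  moreover have "x = top_item profile j {w, x, v}" using j by (auto simp: tops_3_ex_post)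
  ultimately have "x \<in> ?T 3"
    using j7 by (subst round_tops.simps, unfold U3 rem3) (auto simp: items_def)
  then have "x = top_item profile (?own x) {w, x, v}" by (rule top3)
  \<comment> \<open>The owner of \<open>x\<close> must have it on top in round 3; of the three
    candidates, agent 3 already holds \<open>a\<close>.\<close>
  moreover have "k \<in> {3, 4, 5}" if "k \<in> {1..7}" "x = top_item profile k {w, x, v}" for k
    using that unfolding atLeastAtMost_7 by (auto simp: tops_3_ex_post item_neqs)
  ultimately have "?own x \<in> {3, 4, 5}" using own(1) by (simp add: items_def)
  then show ?thesis using own(2)[of x] A3 by (auto simp: items_def item_neqs)
qed

text \<open>Some assignment of positive weight in the decomposition gives \<open>a\<close> to agent
  3, hence \<open>x\<close> to 4 or 5; its weight alone bounds that agent's share of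
  \<open>x\<close> from below.\<close>

lemma ep_FERI_imp_pos:
  assumes ep: "ep_FERI 7 items profile P" and P3: "P 3 a > 0"
  shows "P 4 x > 0 \<or> P 5 x > 0"
proof -
  obtain \<A> u where fin: "finite \<A>"
    and feri: "\<forall>A\<in>\<A>. deterministic_assignment 7 items A \<and> FERI 7 items profile A"
    and nonneg: "\<forall>A\<in>\<A>. (u A :: real) \<ge> 0"
    and P_eq: "\<forall>j\<in>{1..7}. \<forall>q\<in>items. P j q = (\<Sum>A\<in>\<A>. u A * permutation_matrix A j q)"
    using ep unfolding ep_FERI_def by (elim exE conjE) (rule that)
  have "(\<Sum>A\<in>\<A>. u A * permutation_matrix A 3 a) \<noteq> 0"
    using P3 P_eq by (simp add: items_def)
  then obtain A where A: "A \<in> \<A>" "u A * permutation_matrix A 3 a \<noteq> 0"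
    by (rule sum.not_neutral_contains_not_neutral)
  then have "A 3 = a" "u A > 0"
    using nonneg by (auto simp: permutation_matrix_def less_le split: if_splits)
  then obtain j where j: "j \<in> {4, 5}" "A j = x"
    using FERI_imp_x_to_4_or_5 feri A(1) by blast
  have "u A * permutation_matrix A j x \<le> (\<Sum>A\<in>\<A>. u A * permutation_matrix A j x)"
    using A(1) fin nonneg by (intro member_le_sum) (auto simp: permutation_matrix_def)
  also have "\<dots> = P j x" using P_eq j by (auto simp: items_def)
  finally show ?thesis using j \<open>u A > 0\<close> by (auto simp: permutation_matrix_def)
qed

section \<open>The ex-ante side\<close>

lemma ea_FERI_SETE_imp_zero:
  assumes P: "random_assignment 7 items P"
    and ea: "ea_FERI 7 items profile P" and sete: "SETE 7 items profile P"
  shows "P 3 a = 1 / 7" "P 4 x = 0" "P 5 x = 0"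
proof -
  let ?M = "remaining 7 items profile P"
  let ?E = "eager 7 items profile P"
  let ?C = "claimants 7 items profile P"
  have nonneg: "P j q \<ge> 0" if "j \<in> {1..7}" "q \<in> items" for j q
    using P that by (auto simp: random_assignment_def)
  have row: "P j a + P j c + P j z + P j y + P j w + P j x + P j v = 1" if "j \<in> {1..7}" for j
    using P that by (auto simp: random_assignment_def items_def item_neqs add.assoc)
  have col: "P 1 q + P 2 q + P 3 q + P 4 q + P 5 q + P 6 q + P 7 q = 1" if "q \<in> items" for q
    using P that unfolding random_assignment_def atLeastAtMost_7 by (auto simp: add.assoc)

  \<comment> \<open>Agent 3 is the only one with second choice \<open>x\<close>, so its common
    prefix with anybody else is exactly \<open>{a}\<close>.\<close>
  have eq_a: "P j a = P 3 a" if "j \<in> {1, 2, 4, 5, 6, 7}" for j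
    using that
    by (intro SETE_profile[OF sete, of j 3 "[a]" "ranking j ! 1" "drop 2 (ranking j)"])
       (auto simp: ranking_def item_neqs)
  then show P3a: "P 3 a = 1 / 7" using col[of a] by (simp add: items_def)
  have a: "P j a = 1 / 7" if "j \<in> {1..7}" for j
    using that eq_a[of j] P3a unfolding atLeastAtMost_7 by auto
  \<comment> \<open>Comparisons run across the pairs, whose rankings part at \<open>z\<close> versus
    \<open>w\<close>; equality within a pair follows through the other pair.\<close>
  have "P j c = P k c" if "j \<in> {4, 5}" "k \<in> {6, 7}" for j k
    using that
    by (intro SETE_profile[OF sete, of j k "[a, c]" z "[y, x, w, v]" w "[x, z, y, v]"])
       (auto simp: ranking_def item_neqs)
  then have eq_c: "P 4 c = P 6 c" "P 5 c = P 6 c" "P 4 c = P 7 c" by auto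

  have two: "(2::nat) = Suc (Suc 0)" and three: "3 = Suc 2" and four: "4 = Suc 3" and five: "5 = Suc 4"
    by simp_all

  have E1: "?E (Suc 0) q = (if q = a then {1..7} else {})" for q
    using tops_1 by (auto simp: mem_eager_iff remaining_one items_def)
  have C2: "?C 2 q = (if q = a then {1..7} else {})" for q
    unfolding two claimants_Suc[of _ _ _ _ "Suc 0"] E1 claimants_one by simp
  have "q \<in> ?M 2 \<longleftrightarrow> q \<in> items - {a}" for q
  proof -
    have "(\<Sum>k\<in>{1..7}. P k a) = 1" using P by (auto simp: random_assignment_def items_def)
    then show ?thesis
      using mem_remaining_iff[of q 7 items profile P "Suc 0"] C2[of q] by (auto simp: two)
  qed
  then have M2: "?M 2 = {c, z, y, w, x, v}" by (auto simp: items_def item_neqs)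

  have E2: "?E 2 c = {4, 5, 6, 7}" "?E 2 z = {1}" "?E 2 y = {2}" "?E 2 x = {3}"
      "?E 2 w = {}" "?E 2 v = {}"
    unfolding eager.simps[of _ _ _ _ 2] M2 atLeastAtMost_7
    by (auto simp: tops_2 item_neqs)
  have C3: "?C 3 c = {4, 5, 6, 7}" "?C 3 z = {1}" "?C 3 y = {2}" "?C 3 x = {3}"
      "?C 3 w = {}" "?C 3 v = {}"
    unfolding three claimants_Suc[of _ _ _ _ 2] E2 C2 by (simp_all add: item_neqs)
  have sub3: "?M 3 \<subseteq> ?M 2"
    using remaining_Suc_subset[OF P, of profile "Suc 0"] by (simp only: two three)
  \<comment> \<open>If \<open>c\<close> remained, ea-FERI would give each claimant 1 - 1/7 = 6/7 of
    it, too much already for agents 4 and 5 together.\<close>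
  have c_out: "c \<notin> ?M 3"
  proof
    assume "c \<in> ?M 3"
    then have "(\<Sum>q\<in>upper_set items profile j c. P j q) = 1" if "j \<in> {4, 5}" for j
      using that C3(1) ea_FERI_D[OF ea, of c 2 j] by auto
    moreover have "upper_set items profile j c = {c, a}" if "j \<in> {4, 5}" for j
      using that upper_set_profile[of j "[a]" c] by (auto simp: ranking_def)
    ultimately have "P j c + P j a = 1" if "j \<in> {4, 5}" for j
      using that by (auto simp: item_neqs)
    then have "P 4 c = 6 / 7" "P 5 c = 6 / 7"
      using a[of 4] a[of 5] by (simp_all add: eq_diff_eq[symmetric])
    then show False
      using col[of c] nonneg[of 1 c] nonneg[of 2 c] nonneg[of 3 c] nonneg[of 6 c] nonneg[of 7 c]
      by (simp add: items_def)
  qed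
  have "P 4 c + P 5 c + P 6 c + P 7 c = 1"
    using random_assignment_exhausted(1)[OF P, of c profile 2] c_out C3(1)
    by (simp add: items_def add.assoc)
  then have c: "P 6 c = 1 / 4" "P 7 c = 1 / 4" using eq_c by auto
  \<comment> \<open>The 1/7 of \<open>a\<close> leaves at most 6/7 for any other item, so an item
    with a single claimant is not exhausted.\<close>
  have "P j q < 1" if j: "j \<in> {1..7}" and q: "q \<in> {z, y, x}" for j q
  proof -
    have "P j c \<ge> 0" "P j z \<ge> 0" "P j y \<ge> 0" "P j w \<ge> 0" "P j x \<ge> 0" "P j v \<ge> 0"
      using nonneg[OF j] by (simp_all add: items_def)
    then show ?thesis using q row[OF j] a[OF j] by auto
  qed
  then have "P 1 z < 1" "P 2 y < 1" "P 3 x < 1" by simp_all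
  then have "z \<in> ?M 3" "y \<in> ?M 3" "x \<in> ?M 3" "w \<in> ?M 3" "v \<in> ?M 3"
    using mem_remaining_iff[of _ 7 items profile P 2] C3 by (auto simp: items_def)
  then have M3: "?M 3 = {z, y, w, x, v}"
    using sub3 c_out unfolding M2 by (auto simp: item_neqs)

  have E3: "?E 3 y = {2}" "?E 3 x = {3}" "?E 3 w = {6, 7}"
    unfolding eager.simps[of _ _ _ _ 3] M3 atLeastAtMost_7
    by (auto simp: tops_3 item_neqs)
  have C4: "?C 4 y = {2}" "?C 4 x = {3}" "?C 4 w = {6, 7}"
    unfolding four claimants_Suc[of _ _ _ _ 3] E3 C3 by simp_all
  have sub4: "?M 4 \<subseteq> ?M 3"
    using remaining_Suc_subset[OF P, of profile 2] by (simp only: three four)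
  have in4: "y \<in> ?M 4" "x \<in> ?M 4"
    using \<open>P 2 y < 1\<close> \<open>P 3 x < 1\<close> mem_remaining_iff[of _ 7 items profile P 3] C4
    by (auto simp: items_def)
  \<comment> \<open>Otherwise agents 6 and 7 would each get 1 - 1/7 - 1/4 = 17/28 of
    \<open>w\<close>, more than one unit in total.\<close>
  have w_out: "w \<notin> ?M 4"
  proof
    assume "w \<in> ?M 4"
    then have "(\<Sum>q\<in>upper_set items profile j w. P j q) = 1" if "j \<in> {6, 7}" for j
      using that C4(3) ea_FERI_D[OF ea, of w 3 j] by auto
    moreover have "upper_set items profile j w = {w, a, c}" if "j \<in> {6, 7}" for j
      using that upper_set_profile[of j "[a, c]" w] by (auto simp: ranking_def)
    ultimately have "P j w + (P j a + P j c) = 1" if "j \<in> {6, 7}" for j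
      using that by (auto simp: item_neqs)
    then have "P 6 w = 17 / 28" "P 7 w = 17 / 28"
      using a[of 6] a[of 7] c by (simp_all add: eq_diff_eq[symmetric])
    then show False
      using col[of w] nonneg[of 1 w] nonneg[of 2 w] nonneg[of 3 w] nonneg[of 4 w] nonneg[of 5 w]
      by (simp add: items_def)
  qed

  \<comment> \<open>Whether \<open>z\<close> survives round 3 stays open; bounds on the remaining
    set and the presence of \<open>y\<close> and \<open>x\<close> suffice.\<close>
  have M4: "?M 4 \<subseteq> {z, y, x, v}" "{z, y, x, v} \<subseteq> items"
    using sub4 w_out unfolding M3 by (auto simp: items_def)
  have sub: "?M 4 \<subseteq> items" using M4 by (rule order_trans)
  have out: "a \<notin> ?M 4" "c \<notin> ?M 4" "w \<notin> ?M 4" using M4(1) item_neqs by blast+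
  have "top_item profile j (?M 4) = x" if "j \<in> {6, 7}" for j
  proof (rule top_item_profile[OF _ _ sub])
    show "ranking j = [a, c, w] @ x # [z, y, v]" using that by (auto simp: ranking_def)
  qed (use that in4 out in auto)
  then have E4: "{6, 7} \<subseteq> ?E 4 x"
    using in4 by (simp add: mem_eager_iff)
  \<comment> \<open>Agents 4 and 5 ask for \<open>z\<close> if it is left and otherwise for
    \<open>y\<close>, which they also rank above \<open>x\<close>.\<close>
  have "top_item profile j (?M 4) \<noteq> x" if j: "j \<in> {4, 5}" for j
  proof (cases "z \<in> ?M 4")
    case True
    have "top_item profile j (?M 4) = z"
    proof (rule top_item_profile[OF _ _ sub])
      show "ranking j = [a, c] @ z # [y, x, w, v]" using j by (auto simp: ranking_def)
    qed (use j True out in auto)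
    then show ?thesis by (simp add: item_neqs)
  next
    case False
    have "top_item profile j (?M 4) = y"
    proof (rule top_item_profile[OF _ _ sub])
      show "ranking j = [a, c, z] @ y # [x, w, v]" using j by (auto simp: ranking_def)
    qed (use j False in4 out in auto)
    then show ?thesis by (simp add: item_neqs)
  qed
  then have C5: "{3, 6, 7} \<subseteq> ?C 5 x" "4 \<notin> ?C 5 x" "5 \<notin> ?C 5 x"
    using E4 C4(2) unfolding five claimants_Suc[of _ _ _ _ 4] by (auto simp: mem_eager_iff)
  \<comment> \<open>If \<open>x\<close> remained, agent 3 would hold 6/7 of it. Agents 6 and 7
    together would hold 17/14 minus their shares of \<open>w\<close>, so at least 3/14. The total
    15/14 exceeds one unit.\<close>
  have "x \<notin> ?M 5"
  proof
    assume "x \<in> ?M 5"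
    then have sat: "(\<Sum>q\<in>upper_set items profile j x. P j q) = 1" if "j \<in> {3, 6, 7}" for j
      using that C5(1) ea_FERI_D[OF ea, of x 4 j] by auto
    have "P 3 a + P 3 x = 1"
      using sat[of 3] upper_set_profile[of 3 "[a]" x] by (auto simp: ranking_def item_neqs)
    moreover have "upper_set items profile j x = {x, a, c, w}" if "j \<in> {6, 7}" for j
      using that upper_set_profile[of j "[a, c, w]" x] by (auto simp: ranking_def)
    then have "P j a + P j c + P j w + P j x = 1" if "j \<in> {6, 7}" for j
      using that sat[of j] by (auto simp: item_neqs)
    then have "P 6 a + P 6 c + P 6 w + P 6 x = 1" "P 7 a + P 7 c + P 7 w + P 7 x = 1" by auto
    moreover have "P 6 w + P 7 w \<le> 1"
      using col[of w] nonneg[of 1 w] nonneg[of 2 w] nonneg[of 3 w] nonneg[of 4 w] nonneg[of 5 w]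
      by (simp add: items_def)
    ultimately have "P 3 x + P 6 x + P 7 x \<ge> 15 / 14"
      using a[of 3] a[of 6] a[of 7] c by simp
    then show False
      using col[of x] nonneg[of 1 x] nonneg[of 2 x] nonneg[of 4 x] nonneg[of 5 x]
      by (simp add: items_def)
  qed
  then show "P 4 x = 0" "P 5 x = 0"
    using random_assignment_exhausted(2)[OF P, of x profile 4] C5
    by (auto simp: items_def)
qed

section \<open>The contradiction on the profile and its transfer to mechanisms\<close>

lemma profile_incompatible:
  assumes "random_assignment 7 items P" "ep_FERI 7 items profile P"
    "ea_FERI 7 items profile P" "SETE 7 items profile P"
  shows False
  using ep_FERI_imp_pos[of P] ea_FERI_SETE_imp_zero[of P] assms by simp

end

theorem proposition8:
  shows "\<not> (\<exists>f :: ('o::infinite) mechanism.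
           is_mechanism f \<and> mechanism_satisfies f ep_FERI \<and>
           mechanism_satisfies f ea_FERI \<and> mechanism_satisfies f SETE)"
proof
  assume "\<exists>f :: 'o mechanism. is_mechanism f \<and> mechanism_satisfies f ep_FERI \<and>
           mechanism_satisfies f ea_FERI \<and> mechanism_satisfies f SETE"
  then obtain f :: "'o mechanism" where f: "is_mechanism f" "mechanism_satisfies f ep_FERI"
    "mechanism_satisfies f ea_FERI" "mechanism_satisfies f SETE" by blast
  \<comment> \<open>An infinite type supplies seven distinct items, through an injection of the
    naturals.\<close>
  obtain g :: "nat \<Rightarrow> 'o" where g: "inj g"
    using infinite_countable_subset[OF infinite_UNIV] by blast
  interpret seven_items "g 0" "g 1" "g 2" "g 3" "g 4" "g 5" "g 6"
    by unfold_locales (simp add: inj_eq[OF g])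
  show False
    using profile_incompatible[of "f 7 items profile"] f assignment_problem_profile
    by (auto simp: is_mechanism_def mechanism_satisfies_def)
qed

end
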